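(* For every integer $m\geq 2$, the characteristic polynomial $\chi_{S_{m,3}}(x)=\det(xI-BB^T)$ of the staircase $S_{m,3}$ is given by \begin{align*} \chi_{S_{2k,3}}(x)&=(x-2)Q_k\big((x-3)^2\big)\Big[(x-2)Q_k\big((x-3)^2\big)+xQ_{k-1}\big((x-3)^2\big)\Big],\\ \chi_{S_{2k+1,3}}(x)&=\Big[Q_{k+1}\big((x-3)^2\big)+(x-1)Q_k\big((x-3)^2\big)\Big]^2, \end{align*} where $Q_j((x-3)^2)$ denotes the polynomial $Q_j$ evaluated at $(x-3)^2$.
   Context: A snake graph is a plane graph formed by a finite sequence of unit square tiles $T_1,\dots,T_N$ in the plane, each $T_{i+1}$ placed immediately to the right of or immediately on top of $T_i$, so consecutive tiles share exactly one edge. $H_3$ denotes three tiles in a horizontal row and $V_3$ three tiles in a vertical column. The staircase $S_{m,3}$ is the snake graph obtained by gluing $m$ pieces $H_3,V_3,H_3,V_3,\dots$ alternately (starting with $H_3$), where the last tile of each piece is the first tile of the next piece (so $S_{m,3}$ has $2m+1$ tiles). A vertex is a turn if it has exactly $2$ or exactly $4$ neighbours and is neither the lower-right, lower-left nor upper-left vertex of $T_1$, nor the upper-left, upper-right or lower-right vertex of $T_N$. Colour the vertices black and white (adjacent vertices have different colours) so that all turns are black. A weighting $w:E\to\{\pm1\}$ is a Kasteleyn weighting if every face (including the unbounded face) bounded by a $k$-cycle contains an odd number of edges of weight $-1$ when $k\equiv 0 \bmod 4$ and an even number when $k\equiv 2\bmod 4$. Fix a Kasteleyn weighting; $B$ is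 the weighted bipartite adjacency matrix (rows indexed by black vertices, columns by white vertices, entry $w(e)$ if joined by edge $e$, else $0$). For $j\geq1$, $Q_j(x)$ is the characteristic polynomial $\det(xI-M)$ of the $j\times j$ tridiagonal matrix with all sub- and superdiagonal entries $1$ and all diagonal entries $3$; $Q_0=1$. *)

theory Defs
  imports "HOL-Analysis.Convex_Euclidean_Space" "Jordan_Normal_Form.Char_Poly"
begin

section \<open>Snake graphs\<close>

type_synonym vertex = "int \<times> int"
type_synonym edge = "vertex set"

datatype step = East | North

text \<open>A snake graph is given by the list of the moves leading from each tile to the next one.
  A tile is the unit square with integer corners whose lower-left corner is the given point;
  a snake with \<open>n\<close> moves has \<open>n + 1\<close> tiles. The first tile is put at the origin.\<close>

fun tiles_from :: "vertex \<Rightarrow> step list \<Rightarrow> vertex list" where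
  "tiles_from p [] = [p]"
| "tiles_from (x, y) (East # s) = (x, y) # tiles_from (x + 1, y) s"
| "tiles_from (x, y) (North # s) = (x, y) # tiles_from (x, y + 1) s"

definition tiles :: "step list \<Rightarrow> vertex list" where
  "tiles s = tiles_from (0, 0) s"

fun lower_left :: "vertex \<Rightarrow> vertex" where "lower_left (x, y) = (x, y)"
fun lower_right :: "vertex \<Rightarrow> vertex" where "lower_right (x, y) = (x + 1, y)"
fun upper_left :: "vertex \<Rightarrow> vertex" where "upper_left (x, y) = (x, y + 1)"
fun upper_right :: "vertex \<Rightarrow> vertex" where "upper_right (x, y) = (x + 1, y + 1)"

definition tile_vertices :: "vertex \<Rightarrow> vertex set" where
  "tile_vertices t = {lower_left t, lower_right t, upper_left t, upper_right t}"

definition tile_edges :: "vertex \<Rightarrow> edge set" where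
  "tile_edges t = {{lower_left t, lower_right t}, {upper_left t, upper_right t},
                   {lower_left t, upper_left t}, {lower_right t, upper_right t}}"

definition snake_vertices :: "step list \<Rightarrow> vertex set" where
  "snake_vertices s = (\<Union>t \<in> set (tiles s). tile_vertices t)"

definition snake_edges :: "step list \<Rightarrow> edge set" where
  "snake_edges s = (\<Union>t \<in> set (tiles s). tile_edges t)"

definition neighbours :: "step list \<Rightarrow> vertex \<Rightarrow> vertex set" where
  "neighbours s v = {u. {u, v} \<in> snake_edges s}"

text \<open>Gluing two snakes along the last tile of the first and the first tile of the second
  concatenates their lists of moves.\<close>

definition H3 :: "step list" where "H3 = [East, East]"
definition V3 :: "step list" where "V3 = [North, North]"

definition staircase :: "nat \<Rightarrow> step list" where
  "staircase m = concat (map (\<lambda>i. if even i then H3 else V3) [0..<m])"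

section \<open>Turns and colourings\<close>

definition turn :: "step list \<Rightarrow> vertex \<Rightarrow> bool" where
  "turn s v \<longleftrightarrow> v \<in> snake_vertices s
     \<and> (card (neighbours s v) = 2 \<or> card (neighbours s v) = 4)
     \<and> (let t = hd (tiles s) in v \<notin> {lower_right t, lower_left t, upper_left t})
     \<and> (let t = last (tiles s) in v \<notin> {upper_left t, upper_right t, lower_right t})"

text \<open>\<open>black v\<close> means that \<open>v\<close> is black; otherwise it is white.\<close>

definition turn_colouring :: "step list \<Rightarrow> (vertex \<Rightarrow> bool) \<Rightarrow> bool" where
  "turn_colouring s black \<longleftrightarrow>
     (\<forall>u v. {u, v} \<in> snake_edges s \<longrightarrow> black u \<noteq> black v) \<and>
     (\<forall>v. turn s v \<longrightarrow> black v)"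

section \<open>Faces and Kasteleyn weightings\<close>

definition edge_segment :: "edge \<Rightarrow> (real \<times> real) set" where
  "edge_segment e = convex hull ((\<lambda>(x, y). (of_int x, of_int y)) ` e)"

text \<open>The faces are the connected components of the complement of the drawing, the unbounded
  one included. In a snake graph every face is bounded by a cycle, consisting of the edges
  contained in the frontier of the face, so the length of this cycle is the number of those
  edges.\<close>

definition faces :: "edge set \<Rightarrow> (real \<times> real) set set" where
  "faces E = components (- (\<Union>e\<in>E. edge_segment e))"

definition boundary_edges :: "edge set \<Rightarrow> (real \<times> real) set \<Rightarrow> edge set" where
  "boundary_edges E F = {e \<in> E. edge_segment e \<subseteq> frontier F}"

definition kasteleyn_weighting :: "edge set \<Rightarrow> (edge \<Rightarrow> real) \<Rightarrow> bool" where
  "kasteleyn_weighting E w \<longleftrightarrow>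
     (\<forall>e\<in>E. w e = 1 \<or> w e = -1) \<and>
     (\<forall>F\<in>faces E.
        let k = card (boundary_edges E F);
            negs = card {e \<in> boundary_edges E F. w e = -1}
        in (k mod 4 = 0 \<longrightarrow> odd negs) \<and> (k mod 4 = 2 \<longrightarrow> even negs))"

section \<open>Matrices and polynomials\<close>

text \<open>The lists \<open>bs\<close> and \<open>ws\<close> enumerate the black and the white vertices and thereby fix
  the order of the rows and of the columns.\<close>

definition biadjacency_mat ::
  "edge set \<Rightarrow> (edge \<Rightarrow> real) \<Rightarrow> vertex list \<Rightarrow> vertex list \<Rightarrow> real mat" where
  "biadjacency_mat E w bs ws =
     mat (length bs) (length ws)
       (\<lambda>(i, j). if {bs ! i, ws ! j} \<in> E then w {bs ! i, ws ! j} else 0)"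

definition tridiag_mat :: "nat \<Rightarrow> real mat" where
  "tridiag_mat j =
     mat j j (\<lambda>(a, b). if a = b then 3 else if a = Suc b \<or> b = Suc a then 1 else 0)"

definition Q :: "nat \<Rightarrow> real poly" where
  "Q j = (if j = 0 then 1 else char_poly (tridiag_mat j))"

end

theory Submission
  imports Defs
begin

text \<open>The entries of \<open>B B\<^sup>T\<close> are signed counts of common neighbours. If two black vertices are opposite
  corners of a tile, the Kasteleyn condition makes the contributions of the two white corners cancel.
  What remains joins only black vertices at distance two on a straight line, and these pairs form two
  disjoint paths with \<open>m + 1\<close> vertices each. Hence \<open>B B\<^sup>T\<close> is, up to reordering, block diagonal with two
  tridiagonal blocks whose off-diagonal entries are \<open>\<plusminus>1\<close> and whose diagonals are the vertex degrees
  \<open>3, 2, 4, 2, 4, \<dots>\<close> and \<open>2, 4, 2, 4, \<dots>\<close>, changed at the last vertex. Their characteristic polynomials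
  are continuants; with \<open>t = x - 3\<close>, two steps of the recursion have the trace
  \<open>(t + 1)(t - 1) - 2 = t\<^sup>2 - 3\<close>, which is the recursion of \<open>Q\<^sub>j(t\<^sup>2)\<close>.\<close>

section \<open>Tiles of the staircase\<close>

text \<open>The tile with lower-left corner \<open>ll n\<close>, the first tile of the \<open>n\<close>-th piece counted from \<open>0\<close> (or the last one of
  the staircase if \<open>n = m\<close>), has the white vertices \<open>ll n\<close>, \<open>ur n\<close> and the black vertices \<open>inn n\<close>,
  \<open>out n\<close>, of which \<open>inn n\<close> lies on the next tile. The middle tile of the \<open>n\<close>-th piece has \<open>inn n\<close> as
  its lower-left corner.\<close>

definition ll :: "nat \<Rightarrow> vertex" where
  "ll n = (if even n then (int n, int n) else (int n + 1, int n - 1))"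

definition ur :: "nat \<Rightarrow> vertex" where
  "ur n = (if even n then (int n + 1, int n + 1) else (int n + 2, int n))"

definition inn :: "nat \<Rightarrow> vertex" where
  "inn n = (int n + 1, int n)"

definition out :: "nat \<Rightarrow> vertex" where
  "out n = (if even n then (int n, int n + 1) else (int n + 2, int n - 1))"

fun move :: "step \<Rightarrow> vertex \<Rightarrow> vertex" where
  "move East p = lower_right p"
| "move North p = upper_left p"

lemma tiles_from_nonempty [simp]: "tiles_from p s \<noteq> []"
  by (induction p s rule: tiles_from.induct) auto

lemma hd_tiles_from: "hd (tiles_from p s) = p"
  by (induction p s rule: tiles_from.induct) auto

text \<open>\<open>tiles_from\<close> consumes the moves from the front, whereas the staircase grows
  at its end; this recursion at the end drives the induction on the number of pieces.\<close>

lemma tiles_from_snoc: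
  "tiles_from p (s @ [x]) = tiles_from p s @ [move x (last (tiles_from p s))]"
proof (induction p s rule: tiles_from.induct)
  case (1 p)
  then show ?case by (cases p; cases x) auto
qed auto

lemma staircase_Suc: "staircase (Suc m) = staircase m @ (if even m then [East] @ [East] else [North] @ [North])"
  by (simp add: staircase_def H3_def V3_def)

lemma tiles_staircase:
  "set (tiles (staircase m)) = ll ` {..m} \<union> inn ` {..<m} \<and> last (tiles (staircase m)) = ll m"
proof (induction m)
  case 0
  then show ?case by (simp add: tiles_def staircase_def ll_def)
next
  case (Suc m)
  define x where "x = (if even m then East else North)"
  have mv: "move x (move x (ll m)) = ll (Suc m)" "move x (ll m) = inn m" "move x (inn m) = ll (Suc m)"
    by (cases "even m"; simp add: x_def ll_def inn_def)+
  have "tiles (staircase (Suc m)) = tiles (staircase m) @ [inn m, ll (Suc m)]"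
  proof -
    have "staircase (Suc m) = (staircase m @ [x]) @ [x]"
      by (simp add: staircase_Suc x_def)
    then show ?thesis
      using Suc unfolding tiles_def by (simp only: tiles_from_snoc) (simp add: mv)
  qed
  then show ?case using Suc by (auto simp: lessThan_Suc atMost_Suc)
qed

lemma hd_tiles: "hd (tiles s) = (0, 0)"
  by (simp add: tiles_def hd_tiles_from)

text \<open>Naming corners by their role instead of their position treats horizontal and vertical
  pieces alike. The edges are paired by their white corner, the grouping in which the two
  contributions to a Gram entry appear.\<close>

lemma tile_edges_ll:
  "tile_edges (ll n) = {{inn n, ll n}, {out n, ll n}, {inn n, ur n}, {out n, ur n}}"
  by (cases "even n") (simp_all add: tile_edges_def ll_def ur_def inn_def out_def insert_commute add_ac)

lemma tile_edges_inn:
  "tile_edges (inn n) =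
    {{inn n, ll (Suc n)}, {inn (Suc n), ll (Suc n)}, {inn n, ur n}, {inn (Suc n), ur n}}"
  by (cases "even n") (simp_all add: tile_edges_def ll_def ur_def inn_def insert_commute add_ac)

lemma tile_vertices_ll: "tile_vertices (ll n) = {inn n, out n, ll n, ur n}"
  by (cases "even n") (auto simp: tile_vertices_def ll_def ur_def inn_def out_def)

lemma tile_vertices_inn: "tile_vertices (inn n) = {inn n, inn (Suc n), ll (Suc n), ur n}"
  by (cases "even n") (auto simp: tile_vertices_def ll_def ur_def inn_def)

lemma corner_eq_iff [simp]:
  "ll n = ll k \<longleftrightarrow> n = k" "ur n = ur k \<longleftrightarrow> n = k" "inn n = inn k \<longleftrightarrow> n = k" "out n = out k \<longleftrightarrow> n = k"
  by (auto simp: ll_def ur_def inn_def out_def split: if_splits)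

text \<open>The coordinate sums are \<open>2 * n + 1\<close> for \<open>inn n\<close> and
  \<open>out n\<close>, \<open>2 * n\<close> for \<open>ll n\<close> and \<open>2 * n + 2\<close>
  for \<open>ur n\<close>. Parity therefore separates black from white.\<close>

lemma corner_neq [simp]:
  "inn n \<noteq> out k" "inn n \<noteq> ll k" "inn n \<noteq> ur k" "out n \<noteq> ll k" "out n \<noteq> ur k" "ll n \<noteq> ur k"
  "out k \<noteq> inn n" "ll k \<noteq> inn n" "ur k \<noteq> inn n" "ll k \<noteq> out n" "ur k \<noteq> out n" "ur k \<noteq> ll n"
proof -
  show *: "inn n \<noteq> out k" "inn n \<noteq> ll k" "inn n \<noteq> ur k" "out n \<noteq> ll k" "out n \<noteq> ur k"
    by (auto simp: ll_def ur_def inn_def out_def split: if_splits)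
  show **: "ll n \<noteq> ur k"
  proof
    assume eq: "ll n = ur k"
    \<comment> \<open>Comparing coordinate sums forces \<open>n = Suc k\<close>; then
      \<open>n\<close> and \<open>k\<close> have different parity, and the coordinates themselves
      disagree.\<close>
    then have "int n = int (Suc k)"
      by (simp add: ll_def ur_def split: if_splits)
    then have "n = Suc k" by (simp only: of_nat_eq_iff)
    then show False using eq by (simp add: ll_def ur_def split: if_splits)
  qed
  show "out k \<noteq> inn n" "ll k \<noteq> inn n" "ur k \<noteq> inn n" "ll k \<noteq> out n" "ur k \<noteq> out n" "ur k \<noteq> ll n"
    using * ** by metis+
qed

section \<open>Adjacency and colouring of the staircase\<close>

lemma snake_edges_staircase:
  "snake_edges (staircase m) = (\<Union>n\<le>m. tile_edges (ll n)) \<union> (\<Union>n<m. tile_edges (inn n))"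
  using tiles_staircase[of m] by (simp add: snake_edges_def)

lemma snake_vertices_staircase:
  "snake_vertices (staircase m) = inn ` {..m} \<union> out ` {..m} \<union> ll ` {..m} \<union> ur ` {..m}"
  using tiles_staircase[of m] unfolding snake_vertices_def
  by (auto simp: tile_vertices_ll tile_vertices_inn)

text \<open>\<open>inn n\<close> lies on the tile \<open>ll n\<close> and, where they exist, on the
  middle tiles of pieces \<open>n\<close> and \<open>n - 1\<close>. The first supplies
  \<open>ll n\<close> and \<open>ur n\<close>; the middle tiles add \<open>ll (Suc n)\<close> and
  \<open>ur (n - 1)\<close>.\<close>

lemma edge_inn_iff:
  assumes "n \<le> m"
  shows "{inn n, z} \<in> snake_edges (staircase m) \<longleftrightarrow>
    z \<in> {ll n, ur n} \<union> ll ` (if n < m then {Suc n} else {}) \<union> ur ` (if n = 0 then {} else {n - 1})"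
proof -
  have "(\<exists>k<m. Suc k = n \<and> z = ur k) \<longleftrightarrow> (n \<noteq> 0 \<and> z = ur (n - 1))"
    using assms by (cases n) auto
  then show ?thesis using assms unfolding snake_edges_staircase
   by (auto simp: tile_edges_ll tile_edges_inn doubleton_eq_iff)
qed

lemma edge_out_iff:
  assumes "n \<le> m"
  shows "{out n, z} \<in> snake_edges (staircase m) \<longleftrightarrow> z \<in> {ll n, ur n}"
  using assms unfolding snake_edges_staircase
  by (auto simp: tile_edges_ll tile_edges_inn doubleton_eq_iff)

text \<open>One turn suffices to decide which colour class is black. For \<open>m \<ge> 2\<close>
  the tile \<open>ll 1\<close> is neither the first nor the last, so its outer corner is not among
  the excluded vertices.\<close>

lemma turn_out_1:
  assumes "m \<ge> 2"
  shows "turn (staircase m) (out 1)"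
proof -
  have "neighbours (staircase m) (out 1) = {ll 1, ur 1}"
    using edge_out_iff[of 1 m] assms unfolding neighbours_def
    by (subst insert_commute) auto
  then have "card (neighbours (staircase m) (out 1)) = 2" by simp
  moreover have "out 1 \<in> snake_vertices (staircase m)"
    using assms by (auto simp: snake_vertices_staircase)
  moreover have "out 1 \<notin> {upper_left (ll m), upper_right (ll m), lower_right (ll m)}"
    using assms by (auto simp: out_def ll_def; presburger)
  ultimately show ?thesis
    unfolding turn_def hd_tiles using tiles_staircase[of m] by (auto simp: out_def Let_def)
qed

lemma turn_colouring_staircase:
  assumes "m \<ge> 2" "turn_colouring (staircase m) black" "n \<le> m"
  shows "black (inn n)" "black (out n)" "\<not> black (ll n)" "\<not> black (ur n)"
proof -
  have edge: "{u, v} \<in> snake_edges (staircase m) \<Longrightarrow> black u \<noteq> black v" for u v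
    using assms(2) unfolding turn_colouring_def by blast
  have U: "black (inn n) \<noteq> black (ll n) \<and> black (inn n) \<noteq> black (ur n)
      \<and> black (out n) \<noteq> black (ll n)" if "n \<le> m" for n
    using edge[of "inn n" "ll n"] edge[of "inn n" "ur n"] edge[of "out n" "ll n"] that
    by (simp add: edge_inn_iff edge_out_iff)
  have W: "black (inn n) \<noteq> black (ll (Suc n))" if "n < m" for n
    using edge[of "inn n" "ll (Suc n)"] that by (simp add: edge_inn_iff)
  have "black (out 1)"
    using turn_out_1 assms unfolding turn_colouring_def by blast
  then have 1: "black (inn 1)" using U[of 1] assms by auto
  \<comment> \<open>\<open>inn n\<close> and \<open>inn (Suc n)\<close> have the common neighbour
    \<open>ll (Suc n)\<close>.\<close>
  have "n \<le> m \<Longrightarrow> black (inn n) = black (inn 0)" for n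
    by (induction n) (use U W in \<open>auto simp: Suc_le_eq\<close>)
  then have "black (inn n)" using assms(1,3) 1
    by (metis One_nat_def Suc_1 Suc_leD)
  then show "black (inn n)" "black (out n)" "\<not> black (ll n)" "\<not> black (ur n)"
    using U[OF assms(3)] by auto
qed

section \<open>Tridiagonal determinants\<close>

text \<open>The determinant of a tridiagonal matrix with diagonal \<open>d\<close> in which each
  pair of mirrored off-diagonal entries has product 1.\<close>

fun continuant :: "(nat \<Rightarrow> 'a :: comm_ring_1) \<Rightarrow> nat \<Rightarrow> 'a" where
  "continuant d 0 = 1"
| "continuant d (Suc 0) = d 0"
| "continuant d (Suc (Suc n)) = d (Suc n) * continuant d (Suc n) - continuant d n"

lemma continuant_cong:
  "(\<And>i. i < n \<Longrightarrow> d i = e i) \<Longrightarrow> continuant d n = continuant e n"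
  by (induction d n rule: continuant.induct) auto

text \<open>Explicit index equations let the recursion apply to indices such as
  \<open>2 * i + 4\<close>, which are not in the form \<open>Suc (Suc n)\<close>.\<close>

lemma continuant_step:
  "l = n + 1 \<Longrightarrow> k = n + 2 \<Longrightarrow> continuant d k = d l * continuant d l - continuant d n"
  by simp

text \<open>Expansion along the last row, then along the last column of the off-diagonal minor.
  Off-diagonal entries enter only through products of mirrored pairs, so their individual signs do
  not matter.\<close>

lemma det_tridiagonal:
  fixes A :: "'a :: comm_ring_1 mat"
  assumes "A \<in> carrier_mat n n"
    and "\<And>i. i < n \<Longrightarrow> A $$ (i, i) = d i"
    and "\<And>i j. i < n \<Longrightarrow> j < n \<Longrightarrow> Suc i < j \<or> Suc j < i \<Longrightarrow> A $$ (i, j) = 0"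
    and "\<And>i. Suc i < n \<Longrightarrow> A $$ (i, Suc i) * A $$ (Suc i, i) = 1"
  shows "det A = continuant d n"
  using assms
proof (induction d n arbitrary: A rule: continuant.induct)
  case (1 d)
  then show ?case by simp
next
  case (2 d)
  then show ?case by (simp add: det_single)
next
  case (3 d n)
  note A = 3(3)
  have sign: "(-1 :: 'a) ^ (n + n) = 1"
    by simp
  \<comment> \<open>The minor of the entry left of the last diagonal entry. Its last column comes
    from the last column of \<open>A\<close>, where only row \<open>n\<close> can be nonzero;
    deleting that row and column leaves the leading block of size \<open>n\<close>.\<close>
  define M where "M = mat_delete A (Suc n) n"
  have M: "M \<in> carrier_mat (Suc n) (Suc n)"
    using mat_delete_carrier[OF A] by (simp add: M_def)
  have M_last: "M $$ (i, n) = A $$ (i, Suc n)" if "i < Suc n" for i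
    using that A by (simp add: M_def mat_delete_def)
  have "det M = (\<Sum>i<Suc n. M $$ (i, n) * cofactor M i n)"
    by (rule laplace_expansion_column[OF M]) simp
  also have "\<dots> = (\<Sum>i\<in>{n}. M $$ (i, n) * cofactor M i n)"
    using 3(5) by (intro sum.mono_neutral_right) (auto simp: M_last)
  also have "\<dots> = A $$ (n, Suc n) * det (mat_delete M n n)"
    by (simp add: M_last cofactor_def sign)
  also have "det (mat_delete M n n) = continuant d n"
  proof (rule 3(2))
    show carrier: "mat_delete M n n \<in> carrier_mat n n"
      using mat_delete_carrier[OF M, of n n] by simp
    have entry: "mat_delete M n n $$ (i, j) = A $$ (i, j)" if "i < n" "j < n" for i j
      using that A M by (simp add: M_def mat_delete_def)
    show "mat_delete M n n $$ (i, i) = d i" if "i < n" for i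
      using that 3(4)[of i] by (simp only: entry)
    show "mat_delete M n n $$ (i, j) = 0" if "i < n" "j < n" "Suc i < j \<or> Suc j < i" for i j
      using that 3(5)[of i j] by (simp only: entry)
    show "mat_delete M n n $$ (i, Suc i) * mat_delete M n n $$ (Suc i, i) = 1" if "Suc i < n" for i
      using that 3(6)[of i] by (simp only: entry Suc_lessD)
  qed
  finally have det_M: "det M = A $$ (n, Suc n) * continuant d n" .
  define N where "N = mat_delete A (Suc n) (Suc n)"
  have "det N = continuant d (Suc n)"
  proof (rule 3(1))
    show "N \<in> carrier_mat (Suc n) (Suc n)"
      using mat_delete_carrier[OF A] by (simp add: N_def)
    have entry: "N $$ (i, j) = A $$ (i, j)" if "i < Suc n" "j < Suc n" for i j
      using that A by (simp add: N_def mat_delete_def)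
    show "N $$ (i, i) = d i" if "i < Suc n" for i
      using that 3(4)[of i] by (simp only: entry)
    show "N $$ (i, j) = 0" if "i < Suc n" "j < Suc n" "Suc i < j \<or> Suc j < i" for i j
      using that 3(5)[of i j] by (simp only: entry)
    show "N $$ (i, Suc i) * N $$ (Suc i, i) = 1" if "Suc i < Suc n" for i
      using that 3(6)[of i] by (simp only: entry Suc_lessD)
  qed
  then have det_N: "det (mat_delete A (Suc n) (Suc n)) = continuant d (Suc n)"
    by (simp only: N_def)
  have "det A = (\<Sum>j<Suc (Suc n). A $$ (Suc n, j) * cofactor A (Suc n) j)"
    by (rule laplace_expansion_row[OF A]) simp
  also have "\<dots> = (\<Sum>j\<in>{n, Suc n}. A $$ (Suc n, j) * cofactor A (Suc n) j)"
    using 3(5) by (intro sum.mono_neutral_right) auto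
  also have "\<dots> = d (Suc n) * continuant d (Suc n) - A $$ (Suc n, n) * det M"
    using 3(4)[of "Suc n"] by (simp add: cofactor_def det_N M_def sign del: continuant.simps)
  also have "A $$ (Suc n, n) * det M = continuant d n"
  proof -
    have "A $$ (Suc n, n) * det M = A $$ (n, Suc n) * A $$ (Suc n, n) * continuant d n"
      by (simp only: det_M mult_ac)
    then show ?thesis using 3(6)[of n] by simp
  qed
  finally show ?case by (simp only: continuant.simps)
qed

section \<open>Characteristic polynomials of structured matrices\<close>

text \<open>Passing from \<open>A\<close> to \<open>xI - A\<close> negates both entries of a
  mirrored pair and so keeps their product.\<close>

lemma char_poly_tridiagonal:
  fixes A :: "'a :: comm_ring_1 mat"
  assumes A: "A \<in> carrier_mat n n"
    and "\<And>i. i < n \<Longrightarrow> A $$ (i, i) = d i"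
    and "\<And>i j. i < n \<Longrightarrow> j < n \<Longrightarrow> Suc i < j \<or> Suc j < i \<Longrightarrow> A $$ (i, j) = 0"
    and "\<And>i. Suc i < n \<Longrightarrow> A $$ (i, Suc i) * A $$ (Suc i, i) = 1"
  shows "char_poly A = continuant (\<lambda>i. [:- d i, 1:]) n"
  unfolding char_poly_def
proof (rule det_tridiagonal)
  show "char_poly_matrix A \<in> carrier_mat n n" using A by simp
qed (use assms in \<open>auto simp: char_poly_matrix_def one_pCons mult.commute\<close>)

lemma char_poly_block_diagonal:
  fixes A :: "'a :: idom mat"
  assumes A: "A \<in> carrier_mat n n" and D: "D \<in> carrier_mat m m"
  shows "char_poly (four_block_mat A (0\<^sub>m n m) (0\<^sub>m m n) D) = char_poly A * char_poly D"
proof -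
  have "char_poly_matrix (four_block_mat A (0\<^sub>m n m) (0\<^sub>m m n) D) =
    four_block_mat (char_poly_matrix A) (0\<^sub>m n m) (0\<^sub>m m n) (char_poly_matrix D)"
    using A D by (intro eq_matI) (auto simp: char_poly_matrix_def)
  then show ?thesis
    using A D unfolding char_poly_def
    by (simp add: det_four_block_mat_lower_left_zero[where n = n and m = m])
qed

text \<open>Rows and columns are permuted simultaneously, so the sign of the permutation enters
  twice and cancels.\<close>

lemma char_poly_reindex:
  fixes A :: "'a :: comm_ring_1 mat"
  assumes A: "A \<in> carrier_mat n n" and p: "p permutes {..<n}"
  shows "char_poly (mat n n (\<lambda>(i, j). A $$ (p i, p j))) = char_poly A"
proof -
  define C where "C = char_poly_matrix A"
  define D where "D = mat n n (\<lambda>(i, j). C $$ (p i, j))"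
  have p': "p permutes {0..<n}" using p by (simp add: atLeast0LessThan)
  have pn: "p i < n" if "i < n" for i using that p permutes_in_image by fastforce
  have C: "C \<in> carrier_mat n n" using A by (simp add: C_def)
  have D: "D \<in> carrier_mat n n" by (simp add: D_def)
  have "char_poly_matrix (mat n n (\<lambda>(i, j). A $$ (p i, p j))) =
    mat n n (\<lambda>(i, j). C $$ (p i, p j))"
    using A pn permutes_inj[OF p] by (intro eq_matI) (auto simp: char_poly_matrix_def C_def inj_eq)
  \<comment> \<open>The column permutation is written as a row permutation of a transpose, so that
    the rule for rows covers both.\<close>
  also have "\<dots> = transpose_mat (mat n n (\<lambda>(i, j). transpose_mat D $$ (p i, j)))"
    using pn by (intro eq_matI) (auto simp: D_def)
  also have "det \<dots> = signof p * det D"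
    by (subst det_transpose[of _ n], simp, subst det_permute_rows[OF _ p'])
      (simp_all add: D det_transpose[OF D])
  also have "\<dots> = signof p * signof p * det C"
    unfolding D_def by (simp add: det_permute_rows[OF C p'] mult.assoc)
  also have "signof p * signof p = (1 :: 'a poly)"
    by (simp add: sign_def)
  finally show ?thesis by (simp add: char_poly_def C_def)
qed

text \<open>Lets an arbitrary enumeration of the black vertices be replaced by one listing the two
  strands in turn.\<close>

lemma char_poly_mset_eq:
  fixes G :: "'b \<Rightarrow> 'b \<Rightarrow> 'a :: comm_ring_1"
  assumes "mset xs = mset ys"
  shows "char_poly (mat (length xs) (length xs) (\<lambda>(i, j). G (xs ! i) (xs ! j))) =
    char_poly (mat (length ys) (length ys) (\<lambda>(i, j). G (ys ! i) (ys ! j)))"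
proof -
  obtain p where p: "p permutes {..<length ys}" "permute_list p ys = xs"
    using mset_eq_permutation[OF assms] .
  have pn: "p i < length ys" if "i < length ys" for i
    using that p(1) permutes_in_image by fastforce
  have len: "length xs = length ys" using assms by (rule mset_eq_length)
  have "mat (length xs) (length xs) (\<lambda>(i, j). G (xs ! i) (xs ! j)) =
    mat (length ys) (length ys) (\<lambda>(i, j).
      mat (length ys) (length ys) (\<lambda>(i, j). G (ys ! i) (ys ! j)) $$ (p i, p j))"
    using p pn by (intro eq_matI) (auto simp: len permute_list_nth[OF p(1)] simp flip: p(2))
  then show ?thesis by (simp add: char_poly_reindex[OF mat_carrier p(1)])
qed

section \<open>Continuants with alternating diagonal\<close>

text \<open>The diagonal of the strand that starts at \<open>out 0\<close>: degrees 2 and 4 give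
  \<open>x - 2 = t + 1\<close> and \<open>x - 4 = t - 1\<close>. \<open>R j\<close> stands for
  \<open>Q j\<close> at the square of \<open>t\<close>. Both parities are proved in one induction,
  since each step uses the two previous values.\<close>

lemma continuant_alternating:
  fixes R :: "nat \<Rightarrow> 'a :: comm_ring_1"
  assumes R: "R 0 = 1" "R 1 = t\<^sup>2 - 3" "\<And>j. R (Suc (Suc j)) = (t\<^sup>2 - 3) * R (Suc j) - R j"
    and d: "\<And>i. d i = (if even i then t + 1 else t - 1)"
  shows "continuant d (2 * i + 1) = (t + 1) * R i"
    and "continuant d (2 * i + 2) = R (i + 1) + R i"
proof -
  have "continuant d (2 * i + 1) = (t + 1) * R i \<and> continuant d (2 * i + 2) = R (i + 1) + R i"
  proof (induction i)
    case 0
    show ?case using R(1,2) by (simp add: d algebra_simps power2_eq_square)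
  next
    case (Suc i)
    have 3: "continuant d (2 * i + 3) = (t + 1) * R (i + 1)"
    proof -
      have "continuant d (2 * i + 3) =
          (t + 1) * continuant d (2 * i + 2) - continuant d (2 * i + 1)"
        by (subst continuant_step[of "2 * i + 2" "2 * i + 1"]) (simp_all add: d)
      also have "\<dots> = (t + 1) * (R (i + 1) + R i) - (t + 1) * R i"
        using Suc by (simp only:)
      finally show ?thesis
        by (simp add: algebra_simps)
    qed
    have "continuant d (2 * i + 4) =
        (t - 1) * continuant d (2 * i + 3) - continuant d (2 * i + 2)"
      by (subst continuant_step[of "2 * i + 3" "2 * i + 2"]) (simp_all add: d)
    also have "\<dots> = (t - 1) * ((t + 1) * R (i + 1)) - (R (i + 1) + R i)"
      using Suc by (simp only: 3)
    also have "\<dots> = R (i + 2) + R (i + 1)"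
      by (simp add: R(3) algebra_simps power2_eq_square)
    finally have "continuant d (2 * i + 4) = R (i + 2) + R (i + 1)" .
    moreover have "2 * Suc i + 1 = 2 * i + 3" "2 * Suc i + 2 = 2 * i + 4"
        "Suc i = i + 1" "Suc i + 1 = i + 2" by simp_all
    ultimately show ?case using 3 by (simp only:)
  qed
  then show "continuant d (2 * i + 1) = (t + 1) * R i"
    and "continuant d (2 * i + 2) = R (i + 1) + R i" by blast+
qed

text \<open>The diagonal of the strand that starts at \<open>inn 0\<close>, whose degree 3 gives the
  first entry \<open>t\<close>.\<close>

lemma continuant_alternating':
  fixes R :: "nat \<Rightarrow> 'a :: comm_ring_1"
  assumes R: "R 0 = 1" "R 1 = t\<^sup>2 - 3" "\<And>j. R (Suc (Suc j)) = (t\<^sup>2 - 3) * R (Suc j) - R j"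
    and d: "\<And>i. d i = (if i = 0 then t else if even i then t - 1 else t + 1)"
  shows "continuant d (2 * i + 2) = R (i + 1) + (t + 2) * R i"
    and "continuant d (2 * i + 3) = t * R (i + 1) + R i"
proof -
  have "continuant d (2 * i + 2) = R (i + 1) + (t + 2) * R i \<and>
    continuant d (2 * i + 3) = t * R (i + 1) + R i"
  proof (induction i)
    case 0
    have "continuant d 2 = R 1 + (t + 2) * R 0" "continuant d 3 = t * R 1 + R 0"
      unfolding R(1,2) by (simp_all add: d eval_nat_numeral algebra_simps)
    then show ?case by (simp add: numeral_2_eq_2 del: continuant.simps)
  next
    case (Suc i)
    have 4: "continuant d (2 * i + 4) = R (i + 2) + (t + 2) * R (i + 1)"
    proof -
      have "continuant d (2 * i + 4) =
          (t + 1) * continuant d (2 * i + 3) - continuant d (2 * i + 2)"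
        by (subst continuant_step[of "2 * i + 3" "2 * i + 2"]) (simp_all add: d)
      also have "\<dots> = (t + 1) * (t * R (i + 1) + R i) - (R (i + 1) + (t + 2) * R i)"
        using Suc by (simp only:)
      finally show ?thesis
        by (simp add: R(3) algebra_simps power2_eq_square)
    qed
    have "continuant d (2 * i + 5) =
        (t - 1) * continuant d (2 * i + 4) - continuant d (2 * i + 3)"
      by (subst continuant_step[of "2 * i + 4" "2 * i + 3"]) (simp_all add: d)
    also have "\<dots> = (t - 1) * (R (i + 2) + (t + 2) * R (i + 1)) - (t * R (i + 1) + R i)"
      using Suc by (simp only: 4)
    also have "\<dots> = t * R (i + 2) + R (i + 1)"
      by (simp add: R(3) algebra_simps power2_eq_square)
    finally have "continuant d (2 * i + 5) = t * R (i + 2) + R (i + 1)" .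
    moreover have "2 * Suc i + 2 = 2 * i + 4" "2 * Suc i + 3 = 2 * i + 5"
        "Suc i = i + 1" "Suc i + 1 = i + 2" by simp_all
    ultimately show ?case using 4 by (simp only:)
  qed
  then show "continuant d (2 * i + 2) = R (i + 1) + (t + 2) * R i"
    and "continuant d (2 * i + 3) = t * R (i + 1) + R i" by blast+
qed

lemma Q_continuant: "Q j = continuant (\<lambda>_. [:-3, 1:]) j"
proof (cases "j = 0")
  case False
  then show ?thesis unfolding Q_def
    by (simp, intro char_poly_tridiagonal) (auto simp: tridiag_mat_def)
qed (simp add: Q_def)

text \<open>These are the hypotheses on \<open>R\<close> in the two preceding continuant lemmas,
  once \<open>p\<close> is the square of \<open>t\<close>.\<close>

lemma Q_pcompose_rec:
  "pcompose (Q 0) p = 1" "pcompose (Q 1) p = p - 3"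
  "pcompose (Q (Suc (Suc j))) p = (p - 3) * pcompose (Q (Suc j)) p - pcompose (Q j) p"
proof -
  have lin: "pcompose [:-3, 1:] p = p - 3"
    by (simp add: numeral_poly)
  show "pcompose (Q 0) p = 1" "pcompose (Q 1) p = p - 3"
    "pcompose (Q (Suc (Suc j))) p = (p - 3) * pcompose (Q (Suc j)) p - pcompose (Q j) p"
    by (simp_all only: Q_continuant continuant.simps One_nat_def pcompose_diff pcompose_mult lin
      pcompose_1)
qed

section \<open>Tiles as faces\<close>

definition open_tile :: "vertex \<Rightarrow> (real \<times> real) set" where
  "open_tile t = {of_int (fst t)<..<of_int (fst t) + 1} \<times> {of_int (snd t)<..<of_int (snd t) + 1}"

lemma closed_segment_horizontal:
  "closed_segment (a, b) (a + 1, b) = {a..a + 1} \<times> {b :: real}" for a :: real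
proof -
  have "(c, b) \<in> closed_segment (a, b) (a + 1, b)" if "c \<in> {a..a + 1}" for c
    unfolding in_segment by (rule exI[of _ "c - a"]) (use that in \<open>auto simp: algebra_simps\<close>)
  then show ?thesis
    by (auto simp: in_segment algebra_simps)
qed

lemma closed_segment_vertical:
  "closed_segment (a, b) (a, b + 1) = {a} \<times> {b..b + 1 :: real}" for a :: real
proof -
  have "(a, c) \<in> closed_segment (a, b) (a, b + 1)" if "c \<in> {b..b + 1}" for c
    unfolding in_segment by (rule exI[of _ "c - b"]) (use that in \<open>auto simp: algebra_simps\<close>)
  then show ?thesis
    by (auto simp: in_segment algebra_simps)
qed

lemma edge_segment_horizontal:
  "edge_segment {(x, y), (x + 1, y)} = {of_int x..of_int x + 1} \<times> {of_int y}"
  by (simp add: edge_segment_def closed_segment_horizontal flip: segment_convex_hull)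

lemma edge_segment_vertical:
  "edge_segment {(x, y), (x, y + 1)} = {of_int x} \<times> {of_int y..of_int y + 1}"
  by (simp add: edge_segment_def closed_segment_vertical flip: segment_convex_hull)

lemma tile_edges_cases:
  assumes "e \<in> tile_edges t"
  obtains x y where "e = {(x, y), (x + 1, y)}" | x y where "e = {(x, y), (x, y + 1)}"
  using assms by (cases t) (auto simp: tile_edges_def)

lemma frontier_open_tile_box:
  "frontier (open_tile t) =
    {of_int (fst t)..of_int (fst t) + 1} \<times> {of_int (snd t)..of_int (snd t) + 1} - open_tile t"
  unfolding frontier_def open_tile_def
  by (simp add: closure_Times interior_open open_Times)

lemma frontier_open_tile: "frontier (open_tile t) = (\<Union>e\<in>tile_edges t. edge_segment e)"
proof -
  obtain x y where t: "t = (x, y)" by (cases t)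
  show ?thesis
    unfolding frontier_open_tile_box
    by (auto simp: t tile_edges_def edge_segment_horizontal edge_segment_vertical
      edge_segment_horizontal[where y = "y + 1"] edge_segment_vertical[where x = "x + 1"] open_tile_def)
qed

lemma int_between: "\<not> (of_int x < (of_int y :: real) \<and> of_int y < of_int x + (1 :: real))"
proof
  assume "of_int x < (of_int y :: real) \<and> of_int y < of_int x + (1 :: real)"
  then have "of_int x < (of_int y :: real)" "of_int y < (of_int (x + 1) :: real)" by simp_all
  then show False unfolding of_int_less_iff by simp
qed

lemma open_tile_disjoint_edge:
  assumes "e \<in> tile_edges s"
  shows "open_tile t \<inter> edge_segment e = {}"
  using assms
proof (cases rule: tile_edges_cases)
  case (1 x y)
  then show ?thesis
    using int_between[of "snd t" y] by (auto simp: edge_segment_horizontal open_tile_def)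
next
  case (2 x y)
  then show ?thesis
    using int_between[of "fst t" x] by (auto simp: edge_segment_vertical open_tile_def)
qed

text \<open>Both end points are lattice points of the closed square, which leaves only its four
  sides.\<close>

lemma tile_edges_if_in_frontier:
  assumes "e \<in> tile_edges s" "edge_segment e \<subseteq> frontier (open_tile t)"
  shows "e \<in> tile_edges t"
proof -
  obtain x y where t: "t = (x, y)" by (cases t)
  have sub: "edge_segment e \<subseteq> {of_int x..of_int x + 1} \<times> {of_int y..of_int y + 1}"
    using assms(2) unfolding frontier_open_tile_box t by auto
  from assms(1) show ?thesis
  proof (cases rule: tile_edges_cases)
    case (1 a b)
    have "(of_int a, of_int b) \<in> edge_segment e" "(of_int a + 1, of_int b) \<in> edge_segment e"
      unfolding 1 edge_segment_horizontal by auto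
    then have "x \<le> a" "a \<le> x" "y \<le> b" "b \<le> y + 1"
      using sub by auto
    then have "a = x" "b = y \<or> b = y + 1" by auto
    then show ?thesis by (auto simp: 1 t tile_edges_def)
  next
    case (2 a b)
    have "(of_int a, of_int b) \<in> edge_segment e" "(of_int a, of_int b + 1) \<in> edge_segment e"
      unfolding 2 edge_segment_vertical by auto
    then have "y \<le> b" "b \<le> y" "x \<le> a" "a \<le> x + 1"
      using sub by auto
    then have "b = y" "a = x \<or> a = x + 1" by auto
    then show ?thesis by (auto simp: 2 t tile_edges_def)
  qed
qed

lemma card_tile_edges: "card (tile_edges t) = 4"
  by (cases t) (auto simp: tile_edges_def doubleton_eq_iff card_insert_if)

text \<open>The open tile is connected and avoids the drawing, while its frontier consists of drawn
  edges; a connected set in the complement that contains it therefore cannot leave it.\<close>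

lemma open_tile_face:
  assumes "t \<in> set (tiles s)"
  shows "open_tile t \<in> faces (snake_edges s)"
  unfolding faces_def in_components_maximal
proof (intro conjI allI impI)
  let ?D = "\<Union>e\<in>snake_edges s. edge_segment e"
  show "open_tile t \<noteq> {}" by (auto simp: open_tile_def)
  show "open_tile t \<subseteq> - ?D"
    using open_tile_disjoint_edge unfolding snake_edges_def by blast
  show "connected (open_tile t)"
    unfolding open_tile_def by (intro convex_connected convex_Times) simp_all
  fix C
  assume C: "C \<noteq> {} \<and> open_tile t \<subseteq> C \<and> C \<subseteq> - ?D \<and> connected C"
  have "frontier (open_tile t) \<subseteq> ?D"
    unfolding frontier_open_tile using assms by (auto simp: snake_edges_def)
  then have "C \<inter> frontier (open_tile t) = {}" using C by blast
  then have "C - open_tile t = {}"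
    using connected_Int_frontier[of C "open_tile t"] C \<open>open_tile t \<noteq> {}\<close> by blast
  then show "C = open_tile t" using C by blast
qed

lemma boundary_edges_open_tile:
  assumes "t \<in> set (tiles s)"
  shows "boundary_edges (snake_edges s) (open_tile t) = tile_edges t"
proof
  show "boundary_edges (snake_edges s) (open_tile t) \<subseteq> tile_edges t"
    using tile_edges_if_in_frontier unfolding boundary_edges_def snake_edges_def by blast
  show "tile_edges t \<subseteq> boundary_edges (snake_edges s) (open_tile t)"
    using assms by (auto simp: boundary_edges_def snake_edges_def frontier_open_tile)
qed

section \<open>Signs around a tile\<close>

lemma prod_signs:
  fixes w :: "'a \<Rightarrow> real"
  assumes "finite S" "\<And>e. e \<in> S \<Longrightarrow> w e = 1 \<or> w e = -1"
  shows "prod w S = (-1) ^ card {e \<in> S. w e = -1}"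
  using assms
proof (induction S rule: finite_induct)
  case (insert x S)
  have "w x = 1 \<or> w x = -1" using insert.prems by blast
  moreover have "{e \<in> insert x S. w e = -1} =
      (if w x = -1 then insert x {e \<in> S. w e = -1} else {e \<in> S. w e = -1})" by auto
  moreover have "prod w S = (-1) ^ card {e \<in> S. w e = -1}"
    using insert by blast
  ultimately show ?case using insert.hyps by auto
qed simp

text \<open>A tile is a face bounded by a 4-cycle, so an odd number of its edges is negative. The
  product form is what the cancellation of Gram entries needs.\<close>

lemma kasteleyn_tile:
  assumes "kasteleyn_weighting (snake_edges s) w" "t \<in> set (tiles s)"
  shows "prod w (tile_edges t) = -1"
proof -
  have "odd (card {e \<in> boundary_edges (snake_edges s) (open_tile t). w e = -1})"
  proof -
    have "card (boundary_edges (snake_edges s) (open_tile t)) mod 4 = 0"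
      by (simp add: boundary_edges_open_tile[OF assms(2)] card_tile_edges)
    then show ?thesis
      by (rule mp[OF conjunct1[OF bspec[OF conjunct2[OF assms(1)[unfolded kasteleyn_weighting_def Let_def]]
        open_tile_face[OF assms(2)]]]])
  qed
  then have odd: "odd (card {e \<in> tile_edges t. w e = -1})"
    unfolding boundary_edges_open_tile[OF assms(2)] .
  have fin: "finite (tile_edges t)" by (simp add: tile_edges_def)
  have sign: "w e = 1 \<or> w e = -1" if "e \<in> tile_edges t" for e
    using that assms unfolding kasteleyn_weighting_def snake_edges_def by blast
  have "prod w (tile_edges t) = (-1) ^ card {e \<in> tile_edges t. w e = -1}"
    by (rule prod_signs[OF fin sign])
  then show ?thesis using odd by (simp only: minus_one_power_iff if_False)
qed

section \<open>The Gram matrix of the black vertices\<close>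

text \<open>The entries of \<open>B * transpose_mat B\<close>, indexed by vertices instead of list
  positions and hence independent of the enumerations; \<open>Z\<close> is the set of white
  vertices.\<close>

definition gram :: "edge set \<Rightarrow> (edge \<Rightarrow> real) \<Rightarrow> vertex set \<Rightarrow> vertex \<Rightarrow> vertex \<Rightarrow> real" where
  "gram E w Z u v =
    (\<Sum>z\<in>Z. (if {u, z} \<in> E then w {u, z} else 0) * (if {v, z} \<in> E then w {v, z} else 0))"

lemma biadjacency_mult_transpose:
  assumes "distinct ws"
  shows "biadjacency_mat E w bs ws * transpose_mat (biadjacency_mat E w bs ws) =
    mat (length bs) (length bs) (\<lambda>(i, j). gram E w (set ws) (bs ! i) (bs ! j))"
proof (rule eq_matI)
  fix i j
  assume "i < dim_row (mat (length bs) (length bs) (\<lambda>(i, j). gram E w (set ws) (bs ! i) (bs ! j)))"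
    "j < dim_col (mat (length bs) (length bs) (\<lambda>(i, j). gram E w (set ws) (bs ! i) (bs ! j)))"
  then have ij: "i < length bs" "j < length bs" by simp_all
  define f where "f z = (if {bs ! i, z} \<in> E then w {bs ! i, z} else 0) *
    (if {bs ! j, z} \<in> E then w {bs ! j, z} else 0)" for z
  have "(\<Sum>k<length ws. f (ws ! k)) = sum f (set ws)"
    by (rule sum.reindex_bij_betw[OF bij_betw_nth[OF assms refl refl]])
  then show "(biadjacency_mat E w bs ws * transpose_mat (biadjacency_mat E w bs ws)) $$ (i, j) =
    mat (length bs) (length bs) (\<lambda>(i, j). gram E w (set ws) (bs ! i) (bs ! j)) $$ (i, j)"
    using ij by (simp add: biadjacency_mat_def gram_def f_def scalar_prod_def lessThan_atLeast0)
qed (simp_all add: biadjacency_mat_def)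

lemma gram_common_neighbours:
  assumes "finite Z" "{z. {u, z} \<in> E} = U" "{z. {v, z} \<in> E} = V" "U \<subseteq> Z"
  shows "gram E w Z u v = (\<Sum>z\<in>U \<inter> V. w {u, z} * w {v, z})"
proof -
  have "{u, z} \<in> E \<longleftrightarrow> z \<in> U" "{v, z} \<in> E \<longleftrightarrow> z \<in> V" for z using assms by auto
  then show ?thesis unfolding gram_def
    using assms(1,4) by (intro sum.mono_neutral_cong_right) auto
qed

lemma gram_sym: "gram E w Z u v = gram E w Z v u"
  by (simp add: gram_def mult.commute)

section \<open>Gram entries of a Kasteleyn staircase\<close>

locale kasteleyn_staircase =
  fixes m :: nat and w :: "edge \<Rightarrow> real"
  assumes m_pos: "m \<ge> 1"
    and kasteleyn: "kasteleyn_weighting (snake_edges (staircase m)) w"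
begin

definition nb_inn :: "nat \<Rightarrow> vertex set" where
  "nb_inn n = {ll n, ur n} \<union> ll ` (if n < m then {Suc n} else {}) \<union>
    ur ` (if n = 0 then {} else {n - 1})"

definition G :: "vertex \<Rightarrow> vertex \<Rightarrow> real" where
  "G = gram (snake_edges (staircase m)) w (ll ` {..m} \<union> ur ` {..m})"

lemma sign: "e \<in> snake_edges (staircase m) \<Longrightarrow> w e = 1 \<or> w e = -1"
  using kasteleyn by (simp add: kasteleyn_weighting_def)

lemma G_sym: "G u v = G v u"
  by (simp add: G_def gram_sym)

lemma nb_inn: "n \<le> m \<Longrightarrow> {z. {inn n, z} \<in> snake_edges (staircase m)} = nb_inn n"
  unfolding nb_inn_def by (auto simp: edge_inn_iff)

lemma nb_out: "n \<le> m \<Longrightarrow> {z. {out n, z} \<in> snake_edges (staircase m)} = {ll n, ur n}"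
  by (auto simp: edge_out_iff)

lemma G_inn:
  assumes "n \<le> m"
  shows "{z. {v, z} \<in> snake_edges (staircase m)} = V \<Longrightarrow>
    G (inn n) v = (\<Sum>z\<in>nb_inn n \<inter> V. w {inn n, z} * w {v, z})"
  unfolding G_def
  by (rule gram_common_neighbours) (use assms in \<open>auto simp: nb_inn nb_inn_def\<close>)

lemma G_out:
  assumes "n \<le> m"
  shows "{z. {v, z} \<in> snake_edges (staircase m)} = V \<Longrightarrow>
    G (out n) v = (\<Sum>z\<in>{ll n, ur n} \<inter> V. w {out n, z} * w {v, z})"
  unfolding G_def
  by (rule gram_common_neighbours) (use assms in \<open>auto simp: nb_out\<close>)

lemma sign_square: "e \<in> snake_edges (staircase m) \<Longrightarrow> w e * w e = 1"
  using sign by force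

lemma sign_mult_square:
  assumes "e \<in> snake_edges (staircase m)" "f \<in> snake_edges (staircase m)"
  shows "(w e * w f) * (w e * w f) = 1"
  using sign[OF assms(1)] sign[OF assms(2)] by auto

text \<open>Each neighbour contributes the square of a sign, so the diagonal entry is the degree.
  The second premise is the instance of \<open>G_inn\<close> or \<open>G_out\<close> for two equal
  vertices.\<close>

lemma G_diag:
  assumes "{z. {v, z} \<in> snake_edges (staircase m)} = V"
    "G v v = (\<Sum>z\<in>V \<inter> V. w {v, z} * w {v, z})"
  shows "G v v = card V"
  using assms by (auto simp: sign_square)

text \<open>Since \<open>m \<ge> 1\<close>, the two ends are distinct, and each of
  \<open>inn 0\<close> and \<open>inn m\<close> lacks exactly one of the four possible
  neighbours.\<close>

lemma G_inn_diag:
  assumes "n \<le> m"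
  shows "G (inn n) (inn n) = (if n = 0 \<or> n = m then 3 else 4)"
  using assms m_pos G_diag[OF nb_inn G_inn[OF _ nb_inn]]
  by (auto simp: nb_inn_def card_insert_if)

lemma G_out_diag:
  assumes "n \<le> m"
  shows "G (out n) (out n) = 2"
  using assms G_diag[OF nb_out G_out[OF _ nb_out]] by simp

lemma opposite_signs:
  assumes "a * b * c * d = -1" "a = 1 \<or> a = -1" "b = 1 \<or> b = -1" "c = 1 \<or> c = -1" "d = 1 \<or> d = -1"
  shows "a * b + c * d = (0 :: real)"
  using assms by auto

text \<open>The two vertices are opposite corners of a middle tile; the paths through its two white
  corners have opposite signs.\<close>

lemma G_inn_inn_Suc:
  assumes "Suc n \<le> m"
  shows "G (inn n) (inn (Suc n)) = 0"
proof -
  have E: "{inn n, ll (Suc n)} \<in> snake_edges (staircase m)" "{inn (Suc n), ll (Suc n)} \<in> snake_edges (staircase m)"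
    "{inn n, ur n} \<in> snake_edges (staircase m)" "{inn (Suc n), ur n} \<in> snake_edges (staircase m)"
    using assms by (auto simp: edge_inn_iff)
  have "nb_inn n \<inter> nb_inn (Suc n) = {ll (Suc n), ur n}"
    using assms by (auto simp: nb_inn_def)
  then have "G (inn n) (inn (Suc n)) =
      w {inn n, ll (Suc n)} * w {inn (Suc n), ll (Suc n)} + w {inn n, ur n} * w {inn (Suc n), ur n}"
    using assms by (simp add: G_inn[OF _ nb_inn])
  also have "\<dots> = 0"
  proof (rule opposite_signs)
    have "inn n \<in> set (tiles (staircase m))"
      using assms tiles_staircase[of m] by auto
    from kasteleyn_tile[OF kasteleyn this]
    show "w {inn n, ll (Suc n)} * w {inn (Suc n), ll (Suc n)} * w {inn n, ur n} * w {inn (Suc n), ur n} = -1"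
      by (simp add: tile_edges_inn doubleton_eq_iff mult.assoc)
  qed (use E sign in auto)
  finally show ?thesis .
qed

text \<open>The same cancellation across the tile \<open>ll n\<close>.\<close>

lemma G_inn_out_same:
  assumes "n \<le> m"
  shows "G (inn n) (out n) = 0"
proof -
  have E: "{inn n, ll n} \<in> snake_edges (staircase m)" "{out n, ll n} \<in> snake_edges (staircase m)"
    "{inn n, ur n} \<in> snake_edges (staircase m)" "{out n, ur n} \<in> snake_edges (staircase m)"
    using assms by (auto simp: edge_inn_iff edge_out_iff)
  have "nb_inn n \<inter> {ll n, ur n} = {ll n, ur n}"
    by (auto simp: nb_inn_def)
  then have "G (inn n) (out n) =
      w {inn n, ll n} * w {out n, ll n} + w {inn n, ur n} * w {out n, ur n}"
    using assms by (simp add: G_inn[OF _ nb_out])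
  also have "\<dots> = 0"
  proof (rule opposite_signs)
    have "ll n \<in> set (tiles (staircase m))"
      using assms tiles_staircase[of m] by auto
    from kasteleyn_tile[OF kasteleyn this]
    show "w {inn n, ll n} * w {out n, ll n} * w {inn n, ur n} * w {out n, ur n} = -1"
      by (simp add: tile_edges_ll doubleton_eq_iff mult.assoc)
  qed (use E sign in auto)
  finally show ?thesis .
qed

lemma G_inn_inn:
  assumes "n \<le> m" "k \<le> m" "n \<noteq> k"
  shows "G (inn n) (inn k) = 0"
  using assms
proof (induction n k rule: linorder_wlog)
  case (le n k)
  show ?case
  proof (cases "k = Suc n")
    case False
    then have "nb_inn n \<inter> nb_inn k = {}"
      using le by (auto simp: nb_inn_def)
    then show ?thesis using le by (simp add: G_inn[OF _ nb_inn])
  qed (use le G_inn_inn_Suc in auto)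
next
  case (sym n k)
  then show ?case by (metis G_sym)
qed

lemma G_out_out:
  assumes "n \<le> m" "k \<le> m" "n \<noteq> k"
  shows "G (out n) (out k) = 0"
  using assms by (simp add: G_out[OF _ nb_out])

lemma G_inn_out_far:
  assumes "n \<le> m" "k \<le> m" "Suc n < k \<or> Suc k < n"
  shows "G (inn n) (out k) = 0"
proof -
  have "nb_inn n \<inter> {ll k, ur k} = {}"
    using assms by (auto simp: nb_inn_def)
  then show ?thesis using assms by (simp add: G_inn[OF _ nb_out])
qed

text \<open>The single common neighbour \<open>ll (Suc n)\<close> is the midpoint between the two
  vertices, so nothing cancels and the entry is a sign.\<close>

lemma G_inn_out_Suc:
  assumes "Suc n \<le> m"
  shows "G (inn n) (out (Suc n)) * G (inn n) (out (Suc n)) = 1"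
proof -
  have "nb_inn n \<inter> {ll (Suc n), ur (Suc n)} = {ll (Suc n)}"
    using assms by (auto simp: nb_inn_def)
  then have "G (inn n) (out (Suc n)) = w {inn n, ll (Suc n)} * w {out (Suc n), ll (Suc n)}"
    using assms by (simp add: G_inn[OF _ nb_out])
  moreover have "{inn n, ll (Suc n)} \<in> snake_edges (staircase m)"
    "{out (Suc n), ll (Suc n)} \<in> snake_edges (staircase m)"
    using assms by (auto simp: edge_inn_iff edge_out_iff)
  ultimately show ?thesis by (simp only: sign_mult_square)
qed

text \<open>Here the midpoint and only common neighbour is \<open>ur n\<close>.\<close>

lemma G_Suc_inn_out:
  assumes "Suc n \<le> m"
  shows "G (inn (Suc n)) (out n) * G (inn (Suc n)) (out n) = 1"
proof -
  have "nb_inn (Suc n) \<inter> {ll n, ur n} = {ur n}"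
    using assms by (auto simp: nb_inn_def)
  then have "G (inn (Suc n)) (out n) = w {inn (Suc n), ur n} * w {out n, ur n}"
    using assms by (simp add: G_inn[OF _ nb_out])
  moreover have "{inn (Suc n), ur n} \<in> snake_edges (staircase m)"
    "{out n, ur n} \<in> snake_edges (staircase m)"
    using assms by (auto simp: edge_inn_iff edge_out_iff)
  ultimately show ?thesis by (simp only: sign_mult_square)
qed

text \<open>Consecutive vertices of a strand are the pairs on which \<open>B B\<^sup>T\<close> has an off-diagonal entry \<open>\<plusminus>1\<close>.\<close>

definition strand :: "bool \<Rightarrow> nat \<Rightarrow> vertex" where
  "strand p n = (if even n = p then inn n else out n)"

lemma G_strand_far:
  assumes "n \<le> m" "k \<le> m" "Suc n < k \<or> Suc k < n"
  shows "G (strand p n) (strand q k) = 0"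
  using assms G_inn_out_far[of n k] G_inn_out_far[of k n] G_inn_inn[of n k] G_out_out[of n k]
    G_sym[of "out n" "inn k"]
  by (auto simp: strand_def)

lemma G_strand_Suc:
  assumes "Suc n \<le> m"
  shows "G (strand p n) (strand p (Suc n)) * G (strand p (Suc n)) (strand p n) = 1"
  using assms G_inn_out_Suc[of n] G_Suc_inn_out[of n] G_sym[of "inn n" "out (Suc n)"] G_sym[of "out n" "inn (Suc n)"]
  by (auto simp: strand_def)

text \<open>At equal indices the two vertices are opposite corners of the tile \<open>ll n\<close>;
  at neighbouring indices both are of type \<open>inn\<close> or both of type
  \<open>out\<close>.\<close>

lemma G_strand_other:
  assumes "n \<le> m" "k \<le> m"
  shows "G (strand True n) (strand False k) = 0"
proof -
  consider "n = k" | "Suc n < k \<or> Suc k < n" | "k = Suc n" | "n = Suc k" by linarith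
  then show ?thesis
  proof cases
    case 1
    then show ?thesis
      using assms G_inn_out_same[of n] G_sym[of "out n" "inn n"] by (auto simp: strand_def)
  next
    case 2
    then show ?thesis using assms G_strand_far by blast
  next
    case 3
    then show ?thesis
      using assms G_inn_inn[of n "Suc n"] G_out_out[of n "Suc n"] by (auto simp: strand_def)
  next
    case 4
    then show ?thesis
      using assms G_inn_inn[of "Suc k" k] G_out_out[of "Suc k" k] by (auto simp: strand_def)
  qed
qed

lemma char_poly_strand:
  "char_poly (mat (Suc m) (Suc m) (\<lambda>(i, j). G (strand p i) (strand p j))) =
    continuant (\<lambda>i. [:- G (strand p i) (strand p i), 1:]) (Suc m)"
  by (rule char_poly_tridiagonal) (auto simp: G_strand_far G_strand_Suc)

lemma char_poly_strands:
  fixes xs :: "vertex list"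
  defines "xs \<equiv> map (strand True) [0..<Suc m] @ map (strand False) [0..<Suc m]"
  shows "char_poly (mat (length xs) (length xs) (\<lambda>(i, j). G (xs ! i) (xs ! j))) =
    continuant (\<lambda>i. [:- G (strand True i) (strand True i), 1:]) (Suc m) *
    continuant (\<lambda>i. [:- G (strand False i) (strand False i), 1:]) (Suc m)"
proof -
  define M where "M p = mat (Suc m) (Suc m) (\<lambda>(i, j). G (strand p i) (strand p j))" for p
  have M: "M p \<in> carrier_mat (Suc m) (Suc m)" for p by (simp add: M_def)
  have nth: "xs ! i = (if i < Suc m then strand True i else strand False (i - Suc m))"
    if "i < Suc m + Suc m" for i
    using that by (simp add: xs_def nth_append del: upt_Suc)
  have other: "G (strand False k) (strand True n) = 0" if "n \<le> m" "k \<le> m" for n k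
    using G_strand_other[OF that] by (simp add: G_sym)
  have "mat (length xs) (length xs) (\<lambda>(i, j). G (xs ! i) (xs ! j)) =
    four_block_mat (M True) (0\<^sub>m (Suc m) (Suc m)) (0\<^sub>m (Suc m) (Suc m)) (M False)"
    (is "?L = ?R")
  proof (rule eq_matI)
    have len: "length xs = Suc m + Suc m" by (simp add: xs_def)
    show "dim_row ?L = dim_row ?R" "dim_col ?L = dim_col ?R"
      by (simp_all only: len) (simp_all add: M_def)
    fix i j assume "i < dim_row ?R" "j < dim_col ?R"
    then have ij: "i < Suc m + Suc m" "j < Suc m + Suc m" by (simp_all add: M_def)
    then have le: "\<not> i < Suc m \<Longrightarrow> i - Suc m \<le> m" "\<not> j < Suc m \<Longrightarrow> j - Suc m \<le> m" by linarith+
    show "?L $$ (i, j) = ?R $$ (i, j)"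
      using ij le by (simp add: len nth M_def G_strand_other other)
  qed
  then have "char_poly (mat (length xs) (length xs) (\<lambda>(i, j). G (xs ! i) (xs ! j))) =
      char_poly (M True) * char_poly (M False)"
    by (simp only: char_poly_block_diagonal[OF M M])
  then show ?thesis by (simp only: M_def char_poly_strand)
qed

end

section \<open>Evaluation of the two strand polynomials\<close>

text \<open>The continuant is affine in its last diagonal entry. This accounts for
  \<open>inn m\<close>, whose degree 3 replaces the 4 of the periodic pattern.\<close>

lemma continuant_change_last:
  assumes "\<And>i. i < n \<Longrightarrow> e i = d i"
  shows "continuant e (Suc n) = continuant d (Suc n) + (e n - d n) * continuant d n"
proof (cases n)
  case (Suc k)
  have "continuant e n = continuant d n" "continuant e k = continuant d k"
    using assms Suc by (auto intro!: continuant_cong)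
  then show ?thesis
    by (simp add: Suc algebra_simps)
qed simp

context kasteleyn_staircase
begin

text \<open>The exceptional last vertex \<open>inn m\<close> ends the strand \<open>True\<close> for
  even \<open>m\<close> and the strand \<open>False\<close> for odd \<open>m\<close>; the other
  strand ends in \<open>out m\<close> and keeps the alternating pattern.\<close>

lemma continuant_strands:
  fixes t :: "real poly" and R :: "nat \<Rightarrow> real poly"
  assumes t: "t = [:-3, 1:]"
    and R: "R 0 = 1" "R 1 = t\<^sup>2 - 3" "\<And>j. R (Suc (Suc j)) = (t\<^sup>2 - 3) * R (Suc j) - R j"
  defines "dT \<equiv> \<lambda>i. [:- G (strand True i) (strand True i), 1:]"
    and "dF \<equiv> \<lambda>i. [:- G (strand False i) (strand False i), 1:]"
  shows "m = 2 * k \<Longrightarrow> continuant dF (Suc m) = (t + 1) * R k"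
    and "m = 2 * k \<Longrightarrow> continuant dT (Suc m) = (t + 1) * R k + (t + 3) * R (k - 1)"
    and "m = 2 * k + 1 \<Longrightarrow> continuant dT (Suc m) = R (k + 1) + (t + 2) * R k"
    and "m = 2 * k + 1 \<Longrightarrow> continuant dF (Suc m) = R (k + 1) + (t + 2) * R k"
proof -
  have shift: "[:-2, 1:] = t + 1" "[:-4, 1:] = t - 1" "[:-3, 1:] = t"
    by (simp_all add: t one_pCons)
  define e where "e i = (if even i then t + 1 else t - 1)" for i :: nat
  define f where "f i = (if i = 0 then t else if even i then t - 1 else t + 1)" for i :: nat
  have dT: "dT i = (if i = m \<and> even m then t else f i)" if "i \<le> m" for i
    using that m_pos unfolding dT_def f_def strand_def
    by (auto simp: G_inn_diag G_out_diag shift)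
  have dF: "dF i = (if i = m \<and> odd m then t else e i)" if "i \<le> m" for i
    using that m_pos unfolding dF_def e_def strand_def
    by (auto simp: G_inn_diag G_out_diag shift elim: oddE)
  have alt: "continuant e (2 * i + 1) = (t + 1) * R i"
    "continuant e (2 * i + 2) = R (i + 1) + R i" for i
    by (rule continuant_alternating[where R = R and t = t and d = e, OF R]; simp add: e_def)+
  have alt': "continuant f (2 * i + 2) = R (i + 1) + (t + 2) * R i"
    "continuant f (2 * i + 3) = t * R (i + 1) + R i" for i
    by (rule continuant_alternating'[where R = R and t = t and d = f, OF R]; simp add: f_def)+
  {
    assume m: "m = 2 * k"
    have "continuant dF (Suc m) = continuant e (Suc m)"
      by (rule continuant_cong) (simp add: dF m)
    then show "continuant dF (Suc m) = (t + 1) * R k"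
      using alt(1)[of k] m by simp
    \<comment> \<open>Since \<open>m\<close> is positive, \<open>k\<close> is too, so
      \<open>k - 1\<close> is a genuine predecessor.\<close>
    obtain j where j: "k = Suc j" using m m_pos by (cases k) auto
    have "continuant dT (Suc m) = continuant f (Suc m) + (dT m - f m) * continuant f m"
      by (rule continuant_change_last) (simp add: dT m)
    \<comment> \<open>The entry is \<open>t\<close> instead of \<open>t - 1\<close>.\<close>
    also have "dT m - f m = 1"
      using m_pos m dT[of m] by (simp add: f_def)
    also have "continuant f (Suc m) = t * R (j + 1) + R j"
      using alt'(2)[of j] by (simp add: m j numeral_3_eq_3 del: continuant.simps)
    also have "continuant f m = R (j + 1) + (t + 2) * R j"
      using alt'(1)[of j] by (simp add: m j del: continuant.simps)
    finally show "continuant dT (Suc m) = (t + 1) * R k + (t + 3) * R (k - 1)"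
      by (simp add: j algebra_simps)
  next
    assume m: "m = 2 * k + 1"
    have "continuant dT (Suc m) = continuant f (Suc m)"
      by (rule continuant_cong) (simp add: dT m)
    then show "continuant dT (Suc m) = R (k + 1) + (t + 2) * R k"
      using alt'(1)[of k] m by (simp del: continuant.simps)
    have "continuant dF (Suc m) = continuant e (Suc m) + (dF m - e m) * continuant e m"
      by (rule continuant_change_last) (simp add: dF m)
    also have "dF m - e m = 1"
      using m dF[of m] by (simp add: e_def)
    also have "continuant e (Suc m) = R (k + 1) + R k"
      using alt(2)[of k] by (simp add: m del: continuant.simps)
    also have "continuant e m = (t + 1) * R k"
      using alt(1)[of k] by (simp add: m del: continuant.simps)
    finally show "continuant dF (Suc m) = R (k + 1) + (t + 2) * R k"
      by (simp add: algebra_simps)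
  }
qed

end

theorem theorem5p7:
  fixes m :: nat
    and black :: "vertex \<Rightarrow> bool"
    and w :: "edge \<Rightarrow> real"
    and bs ws :: "vertex list"
    and B :: "real mat"
    and X :: "real poly"
    and QQ :: "nat \<Rightarrow> real poly"
  assumes "m \<ge> 2"
    and "turn_colouring (staircase m) black"
    and "kasteleyn_weighting (snake_edges (staircase m)) w"
    and "distinct bs" and "set bs = {v \<in> snake_vertices (staircase m). black v}"
    and "distinct ws" and "set ws = {v \<in> snake_vertices (staircase m). \<not> black v}"
  defines "B \<equiv> biadjacency_mat (snake_edges (staircase m)) w bs ws"
    and "X \<equiv> [:0, 1:]"
    and "QQ \<equiv> (\<lambda>j. pcompose (Q j) ((X - 3)\<^sup>2))"
  shows "\<forall>k. (m = 2 * k \<longrightarrow>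
            char_poly (B * transpose_mat B)
              = (X - 2) * QQ k * ((X - 2) * QQ k + X * QQ (k - 1))) \<and>
          (m = 2 * k + 1 \<longrightarrow>
            char_poly (B * transpose_mat B)
              = (QQ (k + 1) + (X - 1) * QQ k)\<^sup>2)"
proof -
  interpret kasteleyn_staircase m w
    using assms(1,3) by unfold_locales auto
  define xs where "xs = map (strand True) [0..<Suc m] @ map (strand False) [0..<Suc m]"
  note colour = turn_colouring_staircase[OF assms(1,2)]
  have ws: "set ws = ll ` {..m} \<union> ur ` {..m}"
    unfolding assms(7) snake_vertices_staircase using colour by auto
  have "set bs = inn ` {..m} \<union> out ` {..m}"
    unfolding assms(5) snake_vertices_staircase using colour by auto
  also have "\<dots> = set xs"
    unfolding xs_def set_append set_map set_upt atLeast0LessThan lessThan_Suc_atMost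
    by (auto simp: strand_def)
  finally have "set bs = set xs" .
  moreover have "distinct xs"
    unfolding xs_def by (auto simp: distinct_map inj_on_def strand_def split: if_splits)
  ultimately have "mset bs = mset xs"
    using assms(4) set_eq_iff_mset_eq_distinct by blast
  have "char_poly (B * transpose_mat B) =
      char_poly (mat (length bs) (length bs) (\<lambda>(i, j). G (bs ! i) (bs ! j)))"
    unfolding B_def biadjacency_mult_transpose[OF assms(6)] ws G_def ..
  also have "\<dots> = char_poly (mat (length xs) (length xs) (\<lambda>(i, j). G (xs ! i) (xs ! j)))"
    using \<open>mset bs = mset xs\<close> by (rule char_poly_mset_eq)
  finally have char: "char_poly (B * transpose_mat B) =
      continuant (\<lambda>i. [:- G (strand True i) (strand True i), 1:]) (Suc m) *
      continuant (\<lambda>i. [:- G (strand False i) (strand False i), 1:]) (Suc m)"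
    unfolding xs_def char_poly_strands .
  define t where "t = X - 3"
  have t: "t = [:-3, 1:]" by (simp add: t_def X_def numeral_poly)
  have X: "X - 2 = t + 1" "X - 1 = t + 2" "X = t + 3" by (simp_all add: t_def)
  have QQ: "QQ 0 = 1" "QQ 1 = t\<^sup>2 - 3" "QQ (Suc (Suc j)) = (t\<^sup>2 - 3) * QQ (Suc j) - QQ j" for j
    unfolding QQ_def t_def[symmetric] by (rule Q_pcompose_rec)+
  note strands = continuant_strands[of t QQ, OF t QQ]
  \<comment> \<open>For even \<open>m\<close> the strand \<open>False\<close> yields the factor
    \<open>(X - 2) * QQ k\<close> and the strand \<open>True\<close> the bracket; for odd
    \<open>m\<close> both strands yield the same factor, hence the square.\<close>
  show ?thesis
    unfolding char using strands by (auto simp: X(1,2) power2_eq_square mult.commute simp flip: X(3))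
qed

end
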